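(* Assume that $A_t:=\mathbf{E}[|X|^t]<\infty$ for some $t\in(1,2]$. For all $y$ satisfying $y^{t-1}\ge (e-1)A_t a^{-1}$ we have the following inequality: $$\mathbf{P}(M_\tau>x)\le \frac{A_t^{x/y}}{a^{x/y-1}}\,\mathbf{E}[\tau_z]\, y^{-1-(t-1)x/y}\log\left(1+\frac{a y^{t-1}}{A_t}\right)+\left(1+\frac{A_t^{x/y}}{a^{x/y}}\,y^{-(t-1)x/y}\right)\mathbf{E}[\tau_z]\,\mathbf{P}(X>y).$$
   Context: $X_1,X_2,\ldots$ are independent copies of a real random variable $X$ with finite mean and $a:=-\mathbf{E}[X]>0$. $S_0:=0$ and $S_n:=\sum_{i=1}^n X_i$ for $n\ge1$. For $0<z\le x$, $\tau_z:=\min\{k\ge 0: S_k\le -z\}$ (almost surely finite, with finite mean), and $M_\tau:=\max_{1\le k\le \tau_z}S_k$. The level $y$ is positive.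
   Formalization: The condition y ≤ x is added; without it the inequality fails, e.g. X=±1 with mean −0.01, t=2, y=172, x=z=1 gives left side about 0.327 and right side about 0.006. *)

theory Defs
  imports "HOL-Probability.Probability"
begin

definition walk :: "(nat \<Rightarrow> 'a \<Rightarrow> real) \<Rightarrow> nat \<Rightarrow> 'a \<Rightarrow> real" where
  "walk \<xi> n \<omega> = (\<Sum>i=1..n. \<xi> i \<omega>)"

text \<open>
  For negative drift the walk reaches level \<open>- z\<close> almost surely. On the
  exceptional null set the least element below is an unspecified constant.
\<close>

definition hit_time :: "(nat \<Rightarrow> 'a \<Rightarrow> real) \<Rightarrow> real \<Rightarrow> 'a \<Rightarrow> nat" where
  "hit_time \<xi> z \<omega> = (LEAST k. walk \<xi> k \<omega> \<le> - z)"

text \<open>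
  For \<open>z > 0\<close> the hitting time is at least 1 whenever the level is reached, since the
  walk starts at 0; so the maximum below is over a nonempty set almost surely.
\<close>

definition max_before_hit :: "(nat \<Rightarrow> 'a \<Rightarrow> real) \<Rightarrow> real \<Rightarrow> 'a \<Rightarrow> real" where
  "max_before_hit \<xi> z \<omega> = Max ((\<lambda>k. walk \<xi> k \<omega>) ` {1..hit_time \<xi> z \<omega>})"

end

theory Submission
  imports Defs
begin

text \<open>
  Put \<open>q = a y\<^sup>t\<^sup>-\<^sup>1 / A\<close> and \<open>\<theta> = ln (1 + q) / y\<close>. Comparing \<open>e\<^sup>u - 1 - u\<close> with \<open>\<bar>u\<bar>\<^sup>t\<close> shows that
  \<open>E[exp (\<theta> X); X \<le> y] \<le> 1\<close>, the condition on \<open>y\<close> being exactly \<open>\<theta> y \<ge> 1\<close>. Hence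
  \<open>exp (\<theta> S\<^sub>n)\<close>, killed at the first step larger than \<open>y\<close> and stopped on leaving \<open>(-z, x]\<close>, is a
  supermartingale started at 1. Its final value is at least \<open>exp (\<theta> x)\<close> on the event \<open>C\<close> that
  the walk crosses \<open>x\<close> before \<open>\<tau>\<close> and no step up to \<open>\<tau>\<close> exceeds \<open>y\<close>, and at least \<open>1 + \<theta> S\<^sub>\<tau>\<close> if neither
  a crossing nor such a step occurs. As \<open>S\<^sub>\<tau> < 0\<close>, Wald's identity \<open>E[S\<^sub>\<tau>] = - a E[\<tau>]\<close> yields
  \<open>(exp (\<theta> x) - 1) P(C) \<le> P(B) + \<theta> a E[\<tau>]\<close>, where \<open>B\<close> is the event of a step larger than \<open>y\<close> up to \<open>\<tau>\<close>
  and \<open>P(B) \<le> E[\<tau>] P(X > y)\<close>. Finally \<open>exp (\<theta> x) - 1 = (1 + q)\<^sup>p - 1 \<ge> q\<^sup>p\<close> for \<open>p = x / y \<ge> 1\<close>.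
\<close>

subsection \<open>Exponential inequalities\<close>

text \<open>All exponents in the power series of \<open>exp u - 1 - u\<close> are at least 2, hence
  at least \<open>t\<close>. For \<bar>v\<bar> \<le> 1 the factor
  \<open>\<bar>v\<bar> powr t\<close> can therefore be pulled out term by term.\<close>

lemma exp_remainder_le:
  fixes s v t :: real
  assumes "s \<ge> 0" "\<bar>v\<bar> \<le> 1" "t \<le> 2"
  shows "exp (s * v) - 1 - s * v \<le> \<bar>v\<bar> powr t * (exp s - 1 - s)"
proof -
  have e: "(\<lambda>n. u ^ (n + 2) / fact (n + 2)) sums (exp u - 1 - u)" for u :: real
  proof -
    have "(\<lambda>n. u ^ n / fact n) sums exp u"
      using exp_converges[of u] by (simp add: scaleR_conv_of_real field_simps)
    from sums_split_initial_segment[OF this, of 2] show ?thesis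
      by (simp add: numeral_2_eq_2 algebra_simps)
  qed
  show ?thesis
  proof (rule sums_le[OF _ e sums_mult[OF e]])
    fix n
    have "\<bar>v\<bar> ^ (n + 2) \<le> \<bar>v\<bar> powr t"
    proof (cases "v = 0")
      case False
      then have "\<bar>v\<bar> ^ (n + 2) = \<bar>v\<bar> powr real (n + 2)"
        by (subst powr_realpow) auto
      also have "\<dots> \<le> \<bar>v\<bar> powr t"
        using assms False by (intro powr_mono') auto
      finally show ?thesis .
    qed auto
    moreover have "v ^ (n + 2) \<le> \<bar>v\<bar> ^ (n + 2)"
      by (metis abs_ge_self power_abs)
    ultimately have "v ^ (n + 2) * s ^ (n + 2) \<le> \<bar>v\<bar> powr t * s ^ (n + 2)"
      using assms by (intro mult_right_mono) auto
    then have "v ^ (n + 2) * s ^ (n + 2) / fact (n + 2) \<le> \<bar>v\<bar> powr t * s ^ (n + 2) / fact (n + 2)"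
      by (rule divide_right_mono) simp
    then show "(s * v) ^ (n + 2) / fact (n + 2) \<le> \<bar>v\<bar> powr t * (s ^ (n + 2) / fact (n + 2))"
      by (simp only: power_mult_distrib times_divide_eq_right mult.commute)
  qed
qed

text \<open>For \<open>v\<close> below -1 the exponential is at most 1 and only the linear term
  \<open>s * \<bar>v\<bar>\<close> remains. The weaker factor \<open>exp s - 1\<close>, which is at
  least \<open>s\<close>, absorbs it, so one bound serves all \<open>v \<le> 1\<close>.\<close>

lemma exp_quotient_le:
  fixes s v t :: real
  assumes "s \<ge> 0" "v \<le> 1" "1 \<le> t" "t \<le> 2"
  shows "exp (s * v) - 1 - s * v \<le> \<bar>v\<bar> powr t * (exp s - 1)"
proof (cases "v \<ge> -1")
  case True
  have "exp (s * v) - 1 - s * v \<le> \<bar>v\<bar> powr t * (exp s - 1 - s)"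
    using assms True by (intro exp_remainder_le) auto
  also have "\<dots> \<le> \<bar>v\<bar> powr t * (exp s - 1)"
    using assms by (intro mult_left_mono) auto
  finally show ?thesis .
next
  case False
  have "exp (s * v) \<le> 1"
    using assms False by (auto simp: mult_nonneg_nonpos)
  then have "exp (s * v) - 1 - s * v \<le> \<bar>v\<bar> * s"
    using False by simp
  also have "\<dots> \<le> \<bar>v\<bar> powr t * s"
    using powr_mono[of 1 t "\<bar>v\<bar>"] assms False by (intro mult_right_mono) auto
  also have "\<dots> \<le> \<bar>v\<bar> powr t * (exp s - 1)"
    using exp_ge_add_one_self[of s] by (intro mult_left_mono) (linarith, simp)
  finally show ?thesis .
qed

text \<open>Split \<open>(1 + q) powr p\<close> as \<open>(1 + q) * (1 + q) powr (p - 1)\<close> and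
  bound the second factor below by 1 in one summand and by \<open>q powr (p - 1)\<close> in the
  other.\<close>

lemma one_plus_powr_ge:
  fixes p q :: real
  assumes "p \<ge> 1" "q \<ge> 0"
  shows "1 + q powr p \<le> (1 + q) powr p"
proof (cases "q = 0")
  case False
  have "q powr (p - 1) \<le> (1 + q) powr (p - 1)" "1 \<le> (1 + q) powr (p - 1)"
    using assms by (auto intro!: powr_mono2 ge_one_powr_ge_zero)
  then have "1 + q * q powr (p - 1) \<le> (1 + q) powr (p - 1) + q * (1 + q) powr (p - 1)"
    using assms by (intro add_mono mult_left_mono) auto
  also have "\<dots> = (1 + q) powr p"
    using powr_mult_base[of "1 + q" "p - 1"] assms by (simp add: algebra_simps)
  finally show ?thesis
    using powr_mult_base[of q "p - 1"] assms by simp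
qed (use assms in auto)

subsection \<open>Pathwise bounds\<close>

lemma walk_0 [simp]: "walk \<xi> 0 \<omega> = 0"
  by (simp add: walk_def)

lemma walk_Suc: "walk \<xi> (Suc n) \<omega> = walk \<xi> n \<omega> + \<xi> (Suc n) \<omega>"
  by (simp add: walk_def)

lemma walk_eq_sum_Suc: "walk \<xi> n \<omega> = (\<Sum>k<n. \<xi> (Suc k) \<omega>)"
  by (induction n) (simp_all add: walk_Suc)

text \<open>Once level \<open>- z\<close> is reached, this says \<open>k < \<tau>\<close>; it depends on the first \<open>k\<close> steps only.\<close>

definition above :: "(nat \<Rightarrow> 'a \<Rightarrow> real) \<Rightarrow> real \<Rightarrow> nat \<Rightarrow> 'a \<Rightarrow> bool" where
  "above \<xi> z k \<omega> \<longleftrightarrow> (\<forall>j\<le>k. - z < walk \<xi> j \<omega>)"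

definition inside :: "(nat \<Rightarrow> 'a \<Rightarrow> real) \<Rightarrow> real \<Rightarrow> real \<Rightarrow> nat \<Rightarrow> 'a \<Rightarrow> bool" where
  "inside \<xi> z x k \<omega> \<longleftrightarrow> (\<forall>j\<le>k. - z < walk \<xi> j \<omega> \<and> walk \<xi> j \<omega> \<le> x)"

text \<open>With the weight \<open>exp (\<theta> * u) * of_bool (u \<le> y)\<close> this is the
  killed and stopped exponential supermartingale. Stopping is encoded by factors 1 after the exit,
  which shows that only the first \<open>n\<close> steps matter.\<close>

definition stopped_prod ::
    "(nat \<Rightarrow> 'a \<Rightarrow> real) \<Rightarrow> (real \<Rightarrow> real) \<Rightarrow> real \<Rightarrow> real \<Rightarrow> nat \<Rightarrow> 'a \<Rightarrow> real" where
  "stopped_prod \<xi> w z x n \<omega> = (\<Prod>k<n. if inside \<xi> z x k \<omega> then w (\<xi> (Suc k) \<omega>) else 1)"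

lemma stopped_prod_Suc:
  "stopped_prod \<xi> w z x (Suc n) \<omega> = stopped_prod \<xi> w z x n \<omega> * of_bool (\<not> inside \<xi> z x n \<omega>)
    + stopped_prod \<xi> w z x n \<omega> * of_bool (inside \<xi> z x n \<omega>) * w (\<xi> (Suc n) \<omega>)"
  by (simp add: stopped_prod_def)

lemma walk_hit_time_le: "walk \<xi> n \<omega> \<le> - z \<Longrightarrow> walk \<xi> (hit_time \<xi> z \<omega>) \<omega> \<le> - z"
  unfolding hit_time_def by (rule LeastI[of "\<lambda>k. walk \<xi> k \<omega> \<le> - z"])

lemma above_iff_less_hit_time:
  assumes "walk \<xi> n \<omega> \<le> - z"
  shows "above \<xi> z k \<omega> \<longleftrightarrow> k < hit_time \<xi> z \<omega>"
proof -
  note hit = walk_hit_time_le[OF assms]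
  show ?thesis
  proof
    assume "above \<xi> z k \<omega>"
    then show "k < hit_time \<xi> z \<omega>"
      using hit by (meson above_def not_le)
  next
    assume k: "k < hit_time \<xi> z \<omega>"
    show "above \<xi> z k \<omega>"
      unfolding above_def
    proof (intro allI impI)
      fix j assume "j \<le> k"
      with k have "j < (LEAST k. walk \<xi> k \<omega> \<le> - z)"
        by (simp add: hit_time_def)
      from not_less_Least[OF this] show "- z < walk \<xi> j \<omega>" by simp
    qed
  qed
qed

text \<open>Turns a sum up to the random time \<tau> into a series with a fixed index range, so that
  expectation and summation can be interchanged.\<close>

lemma of_bool_above_sums:
  fixes g :: "nat \<Rightarrow> real"
  assumes "\<not> above \<xi> z n \<omega>"
  shows "(\<lambda>k. of_bool (above \<xi> z k \<omega>) * g k) sums (\<Sum>k<hit_time \<xi> z \<omega>. g k)"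
proof -
  obtain j where j: "walk \<xi> j \<omega> \<le> - z"
    using assms by (meson above_def not_le)
  have "(\<lambda>k. of_bool (above \<xi> z k \<omega>) * g k) sums
      (\<Sum>k<hit_time \<xi> z \<omega>. of_bool (above \<xi> z k \<omega>) * g k)"
    by (rule sums_finite) (simp_all add: above_iff_less_hit_time[OF j])
  then show ?thesis
    by (simp add: above_iff_less_hit_time[OF j])
qed

text \<open>The step carries index \<open>Suc k\<close> and the condition time \<open>k\<close>:
  once the level is reached, \<open>above \<xi> z k\<close> means that step \<open>Suc k\<close> is
  taken no later than \<tau>, yet it involves only earlier steps. The same shift is used in
  \<open>crossing\<close>.\<close>

definition big_step :: "(nat \<Rightarrow> 'a \<Rightarrow> real) \<Rightarrow> real \<Rightarrow> real \<Rightarrow> 'a \<Rightarrow> bool" where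
  "big_step \<xi> z y \<omega> \<longleftrightarrow> (\<exists>k. above \<xi> z k \<omega> \<and> y < \<xi> (Suc k) \<omega>)"

definition crossing :: "(nat \<Rightarrow> 'a \<Rightarrow> real) \<Rightarrow> real \<Rightarrow> real \<Rightarrow> 'a \<Rightarrow> bool" where
  "crossing \<xi> z x \<omega> \<longleftrightarrow> (\<exists>k. above \<xi> z k \<omega> \<and> x < walk \<xi> (Suc k) \<omega>)"

text \<open>The left side packs three cases into one expression linear in indicators and in the walk
  at \<tau>. After a big step it is at most 0. Otherwise the product is the exponential at the exit
  time, which is at least \<open>exp (\<theta> * x)\<close> after an upward exit and, by
  \<open>exp u \<ge> 1 + u\<close>, large enough if the exit happens at \<tau>.\<close>

lemma stopped_prod_ge:
  fixes \<theta> x y z :: real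
  assumes "0 < z" "0 < x" "0 \<le> \<theta>" and hit: "\<not> above \<xi> z n \<omega>"
  shows "(exp (\<theta> * x) - 1) * of_bool (crossing \<xi> z x \<omega> \<and> \<not> big_step \<xi> z y \<omega>)
      + 1 - of_bool (big_step \<xi> z y \<omega>) + \<theta> * walk \<xi> (hit_time \<xi> z \<omega>) \<omega>
    \<le> stopped_prod \<xi> (\<lambda>u. exp (\<theta> * u) * of_bool (u \<le> y)) z x n \<omega>" (is "?L \<le> ?U")
proof -
  define \<tau> where "\<tau> = hit_time \<xi> z \<omega>"
  obtain j where j: "walk \<xi> j \<omega> \<le> - z"
    using hit by (meson above_def not_le)
  note above_iff = above_iff_less_hit_time[OF j, folded \<tau>_def]
  have S\<tau>: "walk \<xi> \<tau> \<omega> \<le> - z"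
    unfolding \<tau>_def by (rule walk_hit_time_le[OF j])
  have neg: "\<theta> * walk \<xi> \<tau> \<omega> \<le> 0"
    using assms S\<tau> by (intro mult_nonneg_nonpos) auto
  show ?thesis
  proof (cases "big_step \<xi> z y \<omega>")
    case True
    have "0 \<le> ?U" by (simp add: stopped_prod_def prod_nonneg)
    with True neg show ?thesis by (simp add: \<tau>_def)
  next
    case False
    \<comment> \<open>The exit time from (-z, x], at which the product freezes; it is at most
      \<tau>.\<close>
    define m where "m = (LEAST k. \<not> inside \<xi> z x k \<omega>)"
    have "\<not> inside \<xi> z x \<tau> \<omega>"
      using S\<tau> by (force simp: inside_def)
    then have m: "\<not> inside \<xi> z x m \<omega>" "m \<le> \<tau>"
      unfolding m_def
      using LeastI[of "\<lambda>k. \<not> inside \<xi> z x k \<omega>"] Least_le[of "\<lambda>k. \<not> inside \<xi> z x k \<omega>"]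
      by blast+
    have less_m: "inside \<xi> z x k \<omega>" if "k < m" for k
      using not_less_Least[of k "\<lambda>k. \<not> inside \<xi> z x k \<omega>"] that by (auto simp: m_def)
    have "inside \<xi> z x m \<omega>" if "inside \<xi> z x k \<omega>" "m \<le> k" for k
      using that by (simp add: inside_def)
    with less_m m(1) have in_iff: "inside \<xi> z x k \<omega> \<longleftrightarrow> k < m" for k
      by (meson not_less)
    have "\<tau> \<le> n" using hit by (simp add: above_iff)
    then have "m \<le> n" using m by simp
    have step: "\<xi> (Suc k) \<omega> \<le> y" if "k < m" for k
    proof -
      have "k < \<tau>" using that m by simp
      then have "above \<xi> z k \<omega>" by (simp add: above_iff)
      with False show ?thesis by (auto simp: big_step_def)
    qed
    have "(\<Prod>k<i. exp (\<theta> * \<xi> (Suc k) \<omega>)) = exp (\<theta> * walk \<xi> i \<omega>)" for i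
      by (induction i) (simp_all add: walk_Suc exp_add distrib_left)
    moreover have "?U = (\<Prod>k<m. exp (\<theta> * \<xi> (Suc k) \<omega>))"
      unfolding stopped_prod_def in_iff using \<open>m \<le> n\<close> step
      by (intro prod.mono_neutral_cong_right) auto
    ultimately have U: "?U = exp (\<theta> * walk \<xi> m \<omega>)" by simp
    have before: "walk \<xi> k \<omega> \<le> x" if "k < m" for k
      using less_m[OF that] by (auto simp: inside_def)
    show ?thesis
    proof (cases "x < walk \<xi> m \<omega>")
      case True
      then have "exp (\<theta> * x) \<le> ?U"
        unfolding U using assms by (simp add: mult_left_mono)
      \<comment> \<open>If the indicator of \<open>crossing\<close> were 0, \<open>?L\<close> would
        be at most 1, so its value need not be determined here.\<close>
      moreover have "1 \<le> exp (\<theta> * x)"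
        using assms by simp
      then have "?L \<le> exp (\<theta> * x)"
        using neg False by (cases "crossing \<xi> z x \<omega>") (simp_all add: \<tau>_def del: one_le_exp_iff)
      ultimately show ?thesis by linarith
    next
      case no_cross: False
      have "\<exists>i\<le>m. walk \<xi> i \<omega> \<le> - z \<or> walk \<xi> i \<omega> > x"
        using m(1) by (simp add: inside_def not_less not_le)
      then obtain i where i: "i \<le> m" "walk \<xi> i \<omega> \<le> - z \<or> walk \<xi> i \<omega> > x" by blast
      \<comment> \<open>All positions up to time \<open>m\<close> are at most \<open>x\<close>, so
        the exit is through the lower level and \<open>m\<close> equals \<tau>.\<close>
      have "walk \<xi> i \<omega> \<le> - z"
        using i no_cross before[of i] by (cases "i = m") auto
      then have "\<tau> \<le> i"
        unfolding \<tau>_def hit_time_def by (rule Least_le)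
      with i m have [simp]: "m = \<tau>" by simp
      have "walk \<xi> (Suc k) \<omega> \<le> x" if "k < \<tau>" for k
        using that before[of "Suc k"] no_cross by (cases "Suc k = \<tau>") auto
      then have "\<not> crossing \<xi> z x \<omega>"
        unfolding crossing_def above_iff by (meson not_le)
      then show ?thesis
        using False exp_ge_add_one_self[of "\<theta> * walk \<xi> \<tau> \<omega>"] by (simp add: U \<tau>_def[symmetric])
    qed
  qed
qed

lemma crossing_if_less_max_before_hit:
  assumes "0 < z" "\<not> above \<xi> z n \<omega>" "x < max_before_hit \<xi> z \<omega>"
  shows "crossing \<xi> z x \<omega>"
proof -
  obtain j where j: "walk \<xi> j \<omega> \<le> - z"
    using assms by (meson above_def not_le)
  note above_iff = above_iff_less_hit_time[OF j]
  \<comment> \<open>Positivity of \<open>z\<close> gives \<tau> \<ge> 1, so \<open>Max\<close> is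
    taken over a nonempty set.\<close>
  have "above \<xi> z 0 \<omega>" using assms by (simp add: above_def)
  then have "hit_time \<xi> z \<omega> \<ge> 1" by (simp add: above_iff)
  then obtain k where "k \<in> {1..hit_time \<xi> z \<omega>}" "x < walk \<xi> k \<omega>"
    using assms(3) unfolding max_before_hit_def by (subst (asm) Max_gr_iff) auto
  then show ?thesis
    by (intro crossing_def[THEN iffD2] exI[of _ "k - 1"]) (auto simp: above_iff)
qed

subsection \<open>Walks with independent identically distributed steps\<close>

locale iid_steps = prob_space M for M :: "'a measure" +
  fixes X :: "'a \<Rightarrow> real" and \<xi> :: "nat \<Rightarrow> 'a \<Rightarrow> real"
  assumes X_integrable: "integrable M X"
    and indep: "indep_vars (\<lambda>_. borel) \<xi> {1..}"
    and distr_step: "\<And>i. i \<ge> 1 \<Longrightarrow> distr M borel (\<xi> i) = distr M borel X"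
begin

section \<open>Measurability of the walk, the hitting time and the events\<close>

lemma X_measurable [measurable]: "X \<in> borel_measurable M"
  using X_integrable by simp

lemma step_measurable: "i \<ge> 1 \<Longrightarrow> \<xi> i \<in> borel_measurable M"
  using indep by (auto simp: indep_vars_def)

lemma step_Suc_measurable [measurable]: "\<xi> (Suc n) \<in> borel_measurable M"
  by (rule step_measurable) simp

lemma walk_measurable [measurable]: "walk \<xi> n \<in> borel_measurable M"
  unfolding walk_def[abs_def] by (intro borel_measurable_sum step_measurable) auto

lemma above_measurable [measurable]: "Measurable.pred M (above \<xi> z n)"
  unfolding above_def[abs_def] by measurable

lemma inside_measurable [measurable]: "Measurable.pred M (inside \<xi> z x n)"
  unfolding inside_def[abs_def] by measurable

lemma hit_time_measurable [measurable]: "hit_time \<xi> z \<in> M \<rightarrow>\<^sub>M count_space UNIV"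
  unfolding hit_time_def[abs_def] by measurable

lemma walk_hit_time_measurable [measurable]:
  "(\<lambda>\<omega>. walk \<xi> (hit_time \<xi> z \<omega>) \<omega>) \<in> borel_measurable M"
  by (rule measurable_compose_countable[where g="hit_time \<xi> z"]) auto

lemma big_step_measurable [measurable]: "Measurable.pred M (big_step \<xi> z y)"
  unfolding big_step_def[abs_def] by measurable

lemma crossing_measurable [measurable]: "Measurable.pred M (crossing \<xi> z x)"
  unfolding crossing_def[abs_def] by measurable

section \<open>Laws of the steps and independence of the next step from the past\<close>

lemma integrable_step:
  fixes f :: "real \<Rightarrow> real"
  assumes [measurable]: "f \<in> borel_measurable borel" and "integrable M (\<lambda>\<omega>. f (X \<omega>))"
  shows "integrable M (\<lambda>\<omega>. f (\<xi> (Suc n) \<omega>))"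
  using assms(2) integrable_distr_eq[of "\<xi> (Suc n)" M borel f] integrable_distr_eq[of X M borel f]
    distr_step[of "Suc n"] by simp

lemma expectation_step:
  fixes f :: "real \<Rightarrow> real"
  assumes [measurable]: "f \<in> borel_measurable borel"
  shows "expectation (\<lambda>\<omega>. f (\<xi> (Suc n) \<omega>)) = expectation (\<lambda>\<omega>. f (X \<omega>))"
  using integral_distr[of "\<xi> (Suc n)" M borel f] integral_distr[of X M borel f]
    distr_step[of "Suc n"] by simp

abbreviation past :: "nat \<Rightarrow> 'a \<Rightarrow> nat \<Rightarrow> real" where
  "past n \<omega> \<equiv> restrict (\<lambda>i. \<xi> i \<omega>) {1..n}"

abbreviation history :: "nat \<Rightarrow> (nat \<Rightarrow> real) measure" where
  "history n \<equiv> PiM {1..n} (\<lambda>_. borel)"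

text \<open>The past and step \<open>Suc n\<close> use disjoint index sets of an independent family,
  so they are independent and the expectation factorises. Writing \<open>G\<close> through
  \<open>g\<close> expresses that it is determined by the first \<open>n\<close> steps.\<close>

lemma
  fixes f :: "real \<Rightarrow> real" and g :: "(nat \<Rightarrow> real) \<Rightarrow> real"
  assumes g: "g \<in> borel_measurable (history n)" and G: "\<And>\<omega>. G \<omega> = g (past n \<omega>)"
    and f: "f \<in> borel_measurable borel"
    and int: "integrable M G" "integrable M (\<lambda>\<omega>. f (X \<omega>))"
  shows integrable_past_mult: "integrable M (\<lambda>\<omega>. G \<omega> * f (\<xi> (Suc n) \<omega>))"
    and expectation_past_mult:
      "expectation (\<lambda>\<omega>. G \<omega> * f (\<xi> (Suc n) \<omega>)) = expectation G * expectation (\<lambda>\<omega>. f (X \<omega>))"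
proof -
  have "indep_var (history n) (past n)
      (PiM {Suc n} (\<lambda>_. borel)) (\<lambda>\<omega>. restrict (\<lambda>i. \<xi> i \<omega>) {Suc n})"
    by (intro indep_var_restrict[OF indep]) auto
  moreover have "(\<lambda>p. f (p (Suc n))) \<in> borel_measurable (PiM {Suc n} (\<lambda>_. borel))"
    by (rule measurable_compose[OF _ f], rule measurable_component_singleton) simp
  ultimately have "indep_var borel (g \<circ> past n)
      borel ((\<lambda>p. f (p (Suc n))) \<circ> (\<lambda>\<omega>. restrict (\<lambda>i. \<xi> i \<omega>) {Suc n}))"
    using g by (intro indep_var_compose)
  then have ind: "indep_var borel G borel (\<lambda>\<omega>. f (\<xi> (Suc n) \<omega>))"
    by (simp add: comp_def G[abs_def])
  show "integrable M (\<lambda>\<omega>. G \<omega> * f (\<xi> (Suc n) \<omega>))"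
    by (intro indep_var_integrable[OF ind] int integrable_step f)
  show "expectation (\<lambda>\<omega>. G \<omega> * f (\<xi> (Suc n) \<omega>)) = expectation G * expectation (\<lambda>\<omega>. f (X \<omega>))"
    using indep_var_lebesgue_integral[OF ind int(1) integrable_step[OF f int(2)]]
    by (simp add: expectation_step f)
qed

text \<open>The walk driven by the coordinate projections turns functionals of the walk up to time
  \<open>n\<close> into measurable functions of the history.\<close>

lemma coordinate_walk_measurable:
  "j \<le> n \<Longrightarrow> walk (\<lambda>i p. p i) j \<in> borel_measurable (history n)"
  unfolding walk_def[abs_def]
  by (intro borel_measurable_sum measurable_component_singleton) auto

lemma coordinate_walk_past: "j \<le> n \<Longrightarrow> walk (\<lambda>i p. p i) j (past n \<omega>) = walk \<xi> j \<omega>"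
  by (auto simp: walk_def intro!: sum.cong)

lemma coordinate_above_measurable:
  assumes "k \<le> n"
  shows "Measurable.pred (history n) (above (\<lambda>i p. p i) z k)"
proof -
  have [measurable]: "walk (\<lambda>i p. p i) j \<in> borel_measurable (history n)" if "j \<in> {..k}" for j
    using that assms by (intro coordinate_walk_measurable) auto
  \<comment> \<open>The membership form asks for measurability of the positions up to time
    \<open>k\<close> only, where it has just been provided.\<close>
  have "above (\<lambda>i p. p i) z k = (\<lambda>p. \<forall>j\<in>{..k}. - z < walk (\<lambda>i p. p i) j p)"
    by (auto simp: above_def fun_eq_iff)
  also have "Measurable.pred (history n) \<dots>"
    by measurable
  finally show ?thesis .
qed

lemma coordinate_inside_measurable:
  assumes "k \<le> n"
  shows "Measurable.pred (history n) (inside (\<lambda>i p. p i) z x k)"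
proof -
  have [measurable]: "walk (\<lambda>i p. p i) j \<in> borel_measurable (history n)" if "j \<in> {..k}" for j
    using that assms by (intro coordinate_walk_measurable) auto
  have "inside (\<lambda>i p. p i) z x k =
      (\<lambda>p. \<forall>j\<in>{..k}. - z < walk (\<lambda>i p. p i) j p \<and> walk (\<lambda>i p. p i) j p \<le> x)"
    by (auto simp: inside_def fun_eq_iff)
  also have "Measurable.pred (history n) \<dots>"
    by measurable
  finally show ?thesis .
qed

lemma coordinate_above_past: "k \<le> n \<Longrightarrow> above (\<lambda>i p. p i) z k (past n \<omega>) = above \<xi> z k \<omega>"
  by (simp add: above_def coordinate_walk_past del: One_nat_def)

lemma coordinate_inside_past:
  "k \<le> n \<Longrightarrow> inside (\<lambda>i p. p i) z x k (past n \<omega>) = inside \<xi> z x k \<omega>"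
  by (simp add: inside_def coordinate_walk_past del: One_nat_def)

text \<open>The tail P(\<tau> > k) once the level is reached almost surely; summing over
  \<open>k\<close> then gives the mean of \<tau>.\<close>

abbreviation p_above :: "real \<Rightarrow> nat \<Rightarrow> real" where
  "p_above z k \<equiv> prob {\<omega> \<in> space M. above \<xi> z k \<omega>}"

lemma expectation_of_bool:
  assumes "Measurable.pred M P"
  shows "expectation (\<lambda>\<omega>. of_bool (P \<omega>)) = prob {\<omega> \<in> space M. P \<omega>}"
proof -
  have "expectation (\<lambda>\<omega>. of_bool (P \<omega>)) = expectation (indicator {\<omega> \<in> space M. P \<omega>})"
    by (intro Bochner_Integration.integral_cong) (auto simp: indicator_def)
  also have "\<dots> = prob ({\<omega> \<in> space M. P \<omega>} \<inter> space M)"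
    by simp
  also have "{\<omega> \<in> space M. P \<omega>} \<inter> space M = {\<omega> \<in> space M. P \<omega>}"
    by auto
  finally show ?thesis .
qed

lemma integrable_of_bool:
  assumes [measurable]: "Measurable.pred M P"
  shows "integrable M (\<lambda>\<omega>. of_bool (P \<omega>) :: real)"
  by (rule integrable_const_bound[of _ 1]) auto

text \<open>The event that \<tau> exceeds \<open>n\<close> is determined by the first
  \<open>n\<close> steps, hence independent of the next one. Wald's identity and the union bound for
  big steps both rest on this.\<close>

lemma
  fixes f :: "real \<Rightarrow> real"
  assumes f: "f \<in> borel_measurable borel" "integrable M (\<lambda>\<omega>. f (X \<omega>))"
  shows integrable_above_mult: "integrable M (\<lambda>\<omega>. of_bool (above \<xi> z n \<omega>) * f (\<xi> (Suc n) \<omega>))"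
    and expectation_above_mult:
      "expectation (\<lambda>\<omega>. of_bool (above \<xi> z n \<omega>) * f (\<xi> (Suc n) \<omega>))
        = p_above z n * expectation (\<lambda>\<omega>. f (X \<omega>))"
proof -
  let ?g = "\<lambda>p. of_bool (above (\<lambda>i p. p i) z n p)"
  have g: "?g \<in> borel_measurable (history n)"
    using coordinate_above_measurable[of n n z] by simp
  have G: "of_bool (above \<xi> z n \<omega>) = ?g (past n \<omega>)" for \<omega>
    by (simp add: coordinate_above_past del: One_nat_def)
  note * = g G f(1) integrable_of_bool[OF above_measurable] f(2)
  show "integrable M (\<lambda>\<omega>. of_bool (above \<xi> z n \<omega>) * f (\<xi> (Suc n) \<omega>))"
    by (rule integrable_past_mult[OF *])
  show "expectation (\<lambda>\<omega>. of_bool (above \<xi> z n \<omega>) * f (\<xi> (Suc n) \<omega>))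
        = p_above z n * expectation (\<lambda>\<omega>. f (X \<omega>))"
    by (subst expectation_past_mult[OF *]) (simp_all add: expectation_of_bool)
qed

lemma
  assumes w[measurable]: "w \<in> borel_measurable borel" and w0: "\<And>u. 0 \<le> w u"
    and int: "integrable M (\<lambda>\<omega>. w (X \<omega>))" and le1: "expectation (\<lambda>\<omega>. w (X \<omega>)) \<le> 1"
  shows integrable_stopped_prod: "integrable M (stopped_prod \<xi> w z x n)"
    and expectation_stopped_prod_le: "expectation (stopped_prod \<xi> w z x n) \<le> 1"
proof -
  have "integrable M (stopped_prod \<xi> w z x n) \<and> expectation (stopped_prod \<xi> w z x n) \<le> 1"
  proof (induction n)
    case 0
    then show ?case by (simp add: stopped_prod_def prob_space)
  next
    case (Suc n)
    let ?U = "stopped_prod \<xi> w z x n" and ?c = "stopped_prod (\<lambda>i p. p i) w z x n"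
    let ?G = "\<lambda>\<omega>. ?U \<omega> * of_bool (inside \<xi> z x n \<omega>)"
    let ?R = "\<lambda>\<omega>. ?U \<omega> * of_bool (\<not> inside \<xi> z x n \<omega>)"
    let ?g = "\<lambda>p. ?c p * of_bool (inside (\<lambda>i p. p i) z x n p)"
    have U: "integrable M ?U" "expectation ?U \<le> 1" using Suc by auto
    have U0: "0 \<le> ?U \<omega>" for \<omega> by (simp add: stopped_prod_def prod_nonneg w0)
    have [measurable]: "Measurable.pred (history n) (inside (\<lambda>i p. p i) z x n)"
      by (rule coordinate_inside_measurable) simp
    have "(\<lambda>p. if inside (\<lambda>i p. p i) z x k p then w (p (Suc k)) else 1)
        \<in> borel_measurable (history n)" if "k < n" for k
    proof -
      have [measurable]: "Measurable.pred (history n) (inside (\<lambda>i p. p i) z x k)"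
        using that by (intro coordinate_inside_measurable) simp
      have [measurable]: "(\<lambda>p. w (p (Suc k))) \<in> borel_measurable (history n)"
        using that by (intro measurable_compose[OF _ w] measurable_component_singleton) auto
      show ?thesis by measurable
    qed
    then have "?c \<in> borel_measurable (history n)"
      unfolding stopped_prod_def[abs_def] by (intro borel_measurable_prod) auto
    then have g: "?g \<in> borel_measurable (history n)"
      by measurable
    have "?c (past n \<omega>) = ?U \<omega>" for \<omega>
      unfolding stopped_prod_def by (intro prod.cong) (auto simp: coordinate_inside_past simp del: One_nat_def)
    then have G: "?G \<omega> = ?g (past n \<omega>)" for \<omega>
      by (simp add: coordinate_inside_past del: One_nat_def)
    have intG: "integrable M ?G"
      using U U0 by (intro Bochner_Integration.integrable_bound[OF U(1)]) auto
    have intR: "integrable M ?R"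
      using U U0 by (intro Bochner_Integration.integrable_bound[OF U(1)]) auto
    note * = g G w intG int
    have "expectation (stopped_prod \<xi> w z x (Suc n))
        = expectation ?R + expectation (\<lambda>\<omega>. ?G \<omega> * w (\<xi> (Suc n) \<omega>))"
      unfolding stopped_prod_Suc[abs_def]
      by (intro Bochner_Integration.integral_add intR integrable_past_mult[OF *])
    also have "\<dots> = expectation ?R + expectation ?G * expectation (\<lambda>\<omega>. w (X \<omega>))"
      by (simp only: expectation_past_mult[OF *])
    also have "\<dots> \<le> expectation ?R + expectation ?G * 1"
      by (intro add_left_mono mult_left_mono le1 integral_nonneg_AE) (auto simp: U0)
    also have "\<dots> = expectation (\<lambda>\<omega>. ?R \<omega> + ?G \<omega>)"
      using intR intG by simp
    also have "(\<lambda>\<omega>. ?R \<omega> + ?G \<omega>) = ?U"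
      by (auto simp: fun_eq_iff)
    finally have "expectation (stopped_prod \<xi> w z x (Suc n)) \<le> 1"
      using U(2) by linarith
    moreover have "integrable M (stopped_prod \<xi> w z x (Suc n))"
      unfolding stopped_prod_Suc[abs_def]
      by (intro Bochner_Integration.integrable_add intR integrable_past_mult[OF *])
    ultimately show ?case by simp
  qed
  then show "integrable M (stopped_prod \<xi> w z x n)" "expectation (stopped_prod \<xi> w z x n) \<le> 1"
    by auto
qed

text \<open>Truncating the steps from below keeps the drift negative and bounds the overshoot
  below \<open>- z\<close>; the stopped truncated walk then controls the mean of the hitting time.\<close>

lemma summable_p_above:
  assumes drift: "expectation X < 0" and z: "0 < z"
  shows "summable (p_above z)"
proof -
  \<comment> \<open>By dominated convergence the truncated means tend to the negative mean of
    \<open>X\<close>, so some truncation level \<open>K\<close> keeps the drift negative.\<close>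
  have "(\<lambda>K. expectation (\<lambda>\<omega>. max (X \<omega>) (- real K))) \<longlonglongrightarrow> expectation X"
  proof (rule integral_dominated_convergence[where w="\<lambda>\<omega>. \<bar>X \<omega>\<bar>"])
    show "AE \<omega> in M. (\<lambda>K. max (X \<omega>) (- real K)) \<longlonglongrightarrow> X \<omega>"
    proof (rule AE_I2)
      fix \<omega>
      obtain N :: nat where N: "- X \<omega> \<le> real N" using real_arch_simple by blast
      have "\<forall>\<^sub>F K in sequentially. max (X \<omega>) (- real K) = X \<omega>"
        using eventually_ge_at_top[of N] by eventually_elim (use N in auto)
      then show "(\<lambda>K. max (X \<omega>) (- real K)) \<longlonglongrightarrow> X \<omega>"
        by (rule tendsto_eventually)
    qed
  qed (use X_integrable in auto)
  then have "\<forall>\<^sub>F K in sequentially. expectation (\<lambda>\<omega>. max (X \<omega>) (- real K)) < 0"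
    using drift by (rule order_tendstoD)
  then obtain K :: nat where K: "expectation (\<lambda>\<omega>. max (X \<omega>) (- real K)) < 0"
    by (auto simp: eventually_sequentially)
  define f where "f u = max u (- real K)" for u
  define b where "b = - expectation (\<lambda>\<omega>. f (X \<omega>))"
  have b: "0 < b" using K by (simp add: b_def f_def)
  have f: "f \<in> borel_measurable borel" "integrable M (\<lambda>\<omega>. f (X \<omega>))"
    using X_integrable by (auto simp: f_def[abs_def])
  let ?V = "\<lambda>n \<omega>. \<Sum>k<n. of_bool (above \<xi> z k \<omega>) * f (\<xi> (Suc k) \<omega>)"
  \<comment> \<open>While \<open>above\<close> holds, the truncated walk dominates the walk and so
    exceeds \<open>- z\<close>. The last active step lowers it by at most \<open>K\<close>, and
    afterwards it is frozen.\<close>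
  have lower: "- z - real K \<le> ?V n \<omega> \<and> (above \<xi> z n \<omega> \<longrightarrow> walk \<xi> n \<omega> \<le> ?V n \<omega>)" for n \<omega>
  proof (induction n)
    case 0
    then show ?case using z by simp
  next
    case (Suc n)
    have "above \<xi> z (Suc n) \<omega> \<Longrightarrow> above \<xi> z n \<omega>" "above \<xi> z n \<omega> \<Longrightarrow> - z < walk \<xi> n \<omega>"
      by (auto simp: above_def)
    then show ?case
      using Suc by (cases "above \<xi> z n \<omega>") (auto simp: f_def walk_Suc)
  qed
  show ?thesis
  proof (rule summableI_nonneg_bounded)
    fix n
    have "- z - real K = expectation (\<lambda>\<omega>. - z - real K)"
      by (simp add: prob_space)
    also have "\<dots> \<le> expectation (?V n)"
      using lower
      by (intro integral_mono Bochner_Integration.integrable_sum integrable_above_mult f) auto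
    \<comment> \<open>Each active step contributes mean \<open>- b\<close>, so the lower bound on
      the path becomes an upper bound on the partial sums.\<close>
    also have "\<dots> = (\<Sum>k<n. p_above z k * (- b))"
      by (subst Bochner_Integration.integral_sum)
        (simp_all add: integrable_above_mult expectation_above_mult f b_def)
    finally have "b * (\<Sum>k<n. p_above z k) \<le> z + real K"
      by (simp add: sum_distrib_left sum_negf mult.commute)
    then show "(\<Sum>k<n. p_above z k) \<le> (z + real K) / b"
      using b by (simp add: field_simps)
  qed simp
qed

section \<open>Mean hitting time, Wald's identity and the tail estimates\<close>

context
  fixes z :: real
  assumes drift: "expectation X < 0" and z: "0 < z"
begin

text \<open>Borel-Cantelli applied to the summable tails.\<close>

lemma AE_hit: "AE \<omega> in M. \<exists>n. \<not> above \<xi> z n \<omega>"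
proof -
  have "AE \<omega> in M. \<forall>\<^sub>F n in sequentially. \<omega> \<in> space M - {\<omega> \<in> space M. above \<xi> z n \<omega>}"
    using summable_p_above[OF drift z] by (intro borel_cantelli_AE1) (auto simp: less_top[symmetric])
  then show ?thesis
    by eventually_elim (auto simp: eventually_sequentially)
qed

text \<open>\<tau> is the sum over \<open>k\<close> of the indicators of \<tau> > k; summability of
  the tails allows termwise integration.\<close>

lemma expectation_hit_time:
  "expectation (\<lambda>\<omega>. real (hit_time \<xi> z \<omega>)) = (\<Sum>k. p_above z k)"
proof -
  let ?f = "\<lambda>k \<omega>. of_bool (above \<xi> z k \<omega>) :: real"
  have sums: "AE \<omega> in M. (\<lambda>k. ?f k \<omega>) sums real (hit_time \<xi> z \<omega>)"
    using AE_hit by eventually_elim (use of_bool_above_sums[where g="\<lambda>_. 1"] in auto)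
  have *: "integrable M (?f k)" "AE \<omega> in M. summable (\<lambda>k. norm (?f k \<omega>))"
    "summable (\<lambda>k. expectation (\<lambda>\<omega>. norm (?f k \<omega>)))" for k
    using sums summable_p_above[OF drift z]
    by (auto simp: integrable_of_bool expectation_of_bool sums_iff)
  have eq: "AE \<omega> in M. real (hit_time \<xi> z \<omega>) = (\<Sum>k. ?f k \<omega>)"
    using sums by eventually_elim (simp add: sums_iff)
  have "expectation (\<lambda>\<omega>. real (hit_time \<xi> z \<omega>)) = expectation (\<lambda>\<omega>. \<Sum>k. ?f k \<omega>)"
    using eq by (intro integral_cong_AE) auto
  also have "\<dots> = (\<Sum>k. expectation (?f k))"
    by (rule integral_suminf[OF *])
  finally show ?thesis
    by (simp add: expectation_of_bool)
qed

text \<open>The walk at \<tau> is a series of steps weighted by indicators of \<tau> > k. Its terms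
  have absolute means \<open>p_above z k\<close> times the mean of \<bar>X\<bar>, which are
  summable, so it may be integrated termwise.\<close>

lemma
  shows integrable_walk_hit_time: "integrable M (\<lambda>\<omega>. walk \<xi> (hit_time \<xi> z \<omega>) \<omega>)"
    and Wald_identity: "expectation (\<lambda>\<omega>. walk \<xi> (hit_time \<xi> z \<omega>) \<omega>)
      = expectation (\<lambda>\<omega>. real (hit_time \<xi> z \<omega>)) * expectation X"
proof -
  let ?f = "\<lambda>k \<omega>. of_bool (above \<xi> z k \<omega>) * \<xi> (Suc k) \<omega>"
  have summ: "summable (p_above z)" by (rule summable_p_above[OF drift z])
  have norm_f: "norm (?f k \<omega>) = of_bool (above \<xi> z k \<omega>) * \<bar>\<xi> (Suc k) \<omega>\<bar>" for k \<omega>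
    by (simp add: abs_mult)
  have "expectation (\<lambda>\<omega>. norm (?f k \<omega>)) = p_above z k * expectation (\<lambda>\<omega>. \<bar>X \<omega>\<bar>)" for k
    unfolding norm_f using X_integrable by (intro expectation_above_mult) auto
  moreover have "AE \<omega> in M. summable (\<lambda>k. norm (?f k \<omega>))"
    unfolding norm_f
    using AE_hit
  proof eventually_elim
    case (elim \<omega>)
    then obtain n where "\<not> above \<xi> z n \<omega>" by blast
    from of_bool_above_sums[OF this, where g="\<lambda>k. \<bar>\<xi> (Suc k) \<omega>\<bar>"]
    show "summable (\<lambda>k. of_bool (above \<xi> z k \<omega>) * \<bar>\<xi> (Suc k) \<omega>\<bar>)"
      by (rule sums_summable)
  qed
  ultimately have *: "integrable M (?f k)" "AE \<omega> in M. summable (\<lambda>k. norm (?f k \<omega>))"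
    "summable (\<lambda>k. expectation (\<lambda>\<omega>. norm (?f k \<omega>)))" for k
    using X_integrable integrable_above_mult[of "\<lambda>u. u" z k] summable_mult2[OF summ] by simp_all
  have eq: "AE \<omega> in M. walk \<xi> (hit_time \<xi> z \<omega>) \<omega> = (\<Sum>k. ?f k \<omega>)"
    using AE_hit
    by eventually_elim
      (auto simp: walk_eq_sum_Suc dest!: of_bool_above_sums[where g="\<lambda>k. \<xi> (Suc k) _"] sums_unique)
  have "integrable M (\<lambda>\<omega>. \<Sum>k. ?f k \<omega>)"
    by (rule integrable_suminf[OF *])
  then show "integrable M (\<lambda>\<omega>. walk \<xi> (hit_time \<xi> z \<omega>) \<omega>)"
    using eq by (subst integrable_cong_AE) auto
  have "expectation (\<lambda>\<omega>. walk \<xi> (hit_time \<xi> z \<omega>) \<omega>) = expectation (\<lambda>\<omega>. \<Sum>k. ?f k \<omega>)"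
    using eq by (intro integral_cong_AE) auto
  also have "\<dots> = (\<Sum>k. expectation (?f k))"
    by (rule integral_suminf[OF *])
  also have "\<dots> = (\<Sum>k. p_above z k * expectation X)"
    using expectation_above_mult[of "\<lambda>u. u"] X_integrable by simp
  also have "\<dots> = (\<Sum>k. p_above z k) * expectation X"
    by (rule suminf_mult2[symmetric, OF summ])
  finally show "expectation (\<lambda>\<omega>. walk \<xi> (hit_time \<xi> z \<omega>) \<omega>)
      = expectation (\<lambda>\<omega>. real (hit_time \<xi> z \<omega>)) * expectation X"
    by (simp add: expectation_hit_time)
qed

text \<open>Union bound over the time of the big step; each term factorises by independence.\<close>

lemma prob_big_step_le:
  "prob {\<omega> \<in> space M. big_step \<xi> z y \<omega>}
    \<le> expectation (\<lambda>\<omega>. real (hit_time \<xi> z \<omega>)) * prob {\<omega> \<in> space M. y < X \<omega>}"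
proof -
  let ?A = "\<lambda>k. {\<omega> \<in> space M. above \<xi> z k \<omega> \<and> y < \<xi> (Suc k) \<omega>}"
  let ?q = "prob {\<omega> \<in> space M. y < X \<omega>}"
  have "prob (?A k) = expectation (\<lambda>\<omega>. of_bool (above \<xi> z k \<omega>) * of_bool (y < \<xi> (Suc k) \<omega>))" for k
    by (subst expectation_of_bool[symmetric]) (simp_all add: of_bool_conj)
  also have "\<dots> k = p_above z k * expectation (\<lambda>\<omega>. of_bool (y < X \<omega>))" for k
    by (intro expectation_above_mult integrable_of_bool) auto
  finally have A: "prob (?A k) = p_above z k * ?q" for k
    by (simp add: expectation_of_bool)
  have summ: "summable (p_above z)" by (rule summable_p_above[OF drift z])
  have "prob {\<omega> \<in> space M. big_step \<xi> z y \<omega>} = prob (\<Union>k. ?A k)"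
    by (intro arg_cong[where f=prob]) (auto simp: big_step_def)
  also have "\<dots> \<le> (\<Sum>k. prob (?A k))"
    using summable_mult2[OF summ] by (intro finite_measure_subadditive_countably) (auto simp: A)
  also have "\<dots> = (\<Sum>k. p_above z k) * ?q"
    by (simp add: A suminf_mult2[symmetric, OF summ])
  finally show ?thesis by (simp add: expectation_hit_time)
qed

text \<open>Integrate \<open>stopped_prod_ge\<close> over the paths with \<tau> \<le> n, let
  \<open>n\<close> tend to infinity, and evaluate the limit by Wald's identity.\<close>

lemma prob_crossing_le:
  fixes \<theta> x y :: real
  assumes "0 < x" "0 \<le> \<theta>"
    and exp_le: "expectation (\<lambda>\<omega>. exp (\<theta> * X \<omega>) * of_bool (X \<omega> \<le> y)) \<le> 1"
  shows "(exp (\<theta> * x) - 1) * prob {\<omega> \<in> space M. crossing \<xi> z x \<omega> \<and> \<not> big_step \<xi> z y \<omega>}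
    \<le> prob {\<omega> \<in> space M. big_step \<xi> z y \<omega>}
      - \<theta> * expectation (\<lambda>\<omega>. real (hit_time \<xi> z \<omega>)) * expectation X"
proof -
  let ?C = "\<lambda>\<omega>. crossing \<xi> z x \<omega> \<and> \<not> big_step \<xi> z y \<omega>"
  let ?w = "\<lambda>u. exp (\<theta> * u) * of_bool (u \<le> y)"
  define L where "L \<omega> = (exp (\<theta> * x) - 1) * of_bool (?C \<omega>) + 1 - of_bool (big_step \<xi> z y \<omega>)
    + \<theta> * walk \<xi> (hit_time \<xi> z \<omega>) \<omega>" for \<omega>
  have L: "integrable M L"
    unfolding L_def[abs_def]
    by (intro Bochner_Integration.integrable_add Bochner_Integration.integrable_diff
        integrable_mult_right integrable_of_bool integrable_walk_hit_time) auto
  have "integrable M (\<lambda>\<omega>. ?w (X \<omega>))"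
    by (rule integrable_const_bound[of _ "exp (\<theta> * y)"])
      (use assms in \<open>auto simp: of_bool_def mult_left_mono\<close>)
  note w = _ _ this exp_le
  have U: "integrable M (stopped_prod \<xi> ?w z x n)" "expectation (stopped_prod \<xi> ?w z x n) \<le> 1" for n
    by (rule integrable_stopped_prod[OF w] expectation_stopped_prod_le[OF w]; simp)+
  \<comment> \<open>The indicator restricts to paths where \<open>stopped_prod_ge\<close> applies;
    on the others the product is merely nonnegative. \<open>\<bar>L \<omega>\<bar>\<close> is an
    integrable majorant.\<close>
  have "(\<lambda>n. expectation (\<lambda>\<omega>. of_bool (\<not> above \<xi> z n \<omega>) * L \<omega>)) \<longlonglongrightarrow> expectation L"
  proof (rule integral_dominated_convergence[where w="\<lambda>\<omega>. \<bar>L \<omega>\<bar>"])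
    show "AE \<omega> in M. (\<lambda>n. of_bool (\<not> above \<xi> z n \<omega>) * L \<omega>) \<longlonglongrightarrow> L \<omega>"
      using AE_hit
    proof eventually_elim
      case (elim \<omega>)
      then obtain N where N: "\<not> above \<xi> z N \<omega>" by blast
      have "\<forall>\<^sub>F n in sequentially. of_bool (\<not> above \<xi> z n \<omega>) * L \<omega> = L \<omega>"
        using eventually_ge_at_top[of N]
      proof eventually_elim
        case (elim n)
        have "above \<xi> z n \<omega> \<Longrightarrow> above \<xi> z N \<omega>" using elim by (simp add: above_def)
        with N show ?case by auto
      qed
      then show ?case by (rule tendsto_eventually)
    qed
    show "L \<in> borel_measurable M" using L by simp
    then show "(\<lambda>\<omega>. of_bool (\<not> above \<xi> z n \<omega>) * L \<omega>) \<in> borel_measurable M" for n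
      by measurable
    show "integrable M (\<lambda>\<omega>. \<bar>L \<omega>\<bar>)" using L by simp
  qed (auto simp: of_bool_def)
  moreover have "expectation (\<lambda>\<omega>. of_bool (\<not> above \<xi> z n \<omega>) * L \<omega>) \<le> 1" for n
  proof -
    have "of_bool (\<not> above \<xi> z n \<omega>) * L \<omega> \<le> stopped_prod \<xi> ?w z x n \<omega>" for \<omega>
    proof (cases "above \<xi> z n \<omega>")
      case True
      then show ?thesis by (simp add: stopped_prod_def prod_nonneg)
    next
      case False
      from stopped_prod_ge[OF z assms(1,2) this] show ?thesis
        using False by (simp add: L_def)
    qed
    moreover have "integrable M (\<lambda>\<omega>. of_bool (\<not> above \<xi> z n \<omega>) * L \<omega>)"
      using L by (intro Bochner_Integration.integrable_bound[OF L]) auto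
    ultimately have "expectation (\<lambda>\<omega>. of_bool (\<not> above \<xi> z n \<omega>) * L \<omega>)
        \<le> expectation (stopped_prod \<xi> ?w z x n)"
      by (intro integral_mono U)
    then show ?thesis by (rule order_trans[OF _ U(2)])
  qed
  ultimately have "expectation L \<le> 1"
    by (intro LIMSEQ_le_const2) auto
  moreover have "expectation L = (exp (\<theta> * x) - 1) * prob {\<omega> \<in> space M. ?C \<omega>}
      + 1 - prob {\<omega> \<in> space M. big_step \<xi> z y \<omega>}
      + \<theta> * expectation (\<lambda>\<omega>. walk \<xi> (hit_time \<xi> z \<omega>) \<omega>)"
  proof -
    have i1: "integrable M (\<lambda>\<omega>. (exp (\<theta> * x) - 1) * of_bool (?C \<omega>))"
      by (intro integrable_mult_right integrable_of_bool) measurable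
    have i2: "integrable M (\<lambda>\<omega>. of_bool (big_step \<xi> z y \<omega>) :: real)"
      by (intro integrable_of_bool) measurable
    have e1: "expectation (\<lambda>\<omega>. of_bool (?C \<omega>)) = prob {\<omega> \<in> space M. ?C \<omega>}"
      by (intro expectation_of_bool) measurable
    have e2: "expectation (\<lambda>\<omega>. of_bool (big_step \<xi> z y \<omega>)) = prob {\<omega> \<in> space M. big_step \<xi> z y \<omega>}"
      by (intro expectation_of_bool) measurable
    show ?thesis
      unfolding L_def[abs_def] using i1 i2 integrable_walk_hit_time
      by (simp add: prob_space e1 e2 del: of_bool_conj)
  qed
  ultimately show ?thesis
    by (simp add: Wald_identity)
qed

text \<open>The inclusion of events holds only almost everywhere, because
  \<open>max_before_hit\<close> is unspecified on paths that never reach the level.\<close>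

lemma prob_max_before_hit_le:
  "prob {\<omega> \<in> space M. x < max_before_hit \<xi> z \<omega>}
    \<le> prob {\<omega> \<in> space M. big_step \<xi> z y \<omega>}
      + prob {\<omega> \<in> space M. crossing \<xi> z x \<omega> \<and> \<not> big_step \<xi> z y \<omega>}"
proof -
  let ?B = "{\<omega> \<in> space M. big_step \<xi> z y \<omega>}"
    and ?C = "{\<omega> \<in> space M. crossing \<xi> z x \<omega> \<and> \<not> big_step \<xi> z y \<omega>}"
  have "prob {\<omega> \<in> space M. x < max_before_hit \<xi> z \<omega>} \<le> prob (?B \<union> ?C)"
  proof (rule finite_measure_mono_AE)
    show "AE \<omega> in M. \<omega> \<in> {\<omega> \<in> space M. x < max_before_hit \<xi> z \<omega>} \<longrightarrow> \<omega> \<in> ?B \<union> ?C"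
      using AE_hit by eventually_elim (auto dest: crossing_if_less_max_before_hit[OF z])
  qed auto
  also have "\<dots> \<le> prob ?B + prob ?C"
    by (rule measure_Un_le) auto
  finally show ?thesis .
qed

end

end

subsection \<open>The truncated exponential moment\<close>

text \<open>\<open>exp_quotient_le\<close> with \<open>s = \<theta> * y\<close> and
  \<open>v = u / y\<close> bounds the integrand by \<open>?r\<close>, since
  \<open>exp s - 1 = q\<close>. The mean of \<open>?r\<close> is
  \<open>1 - \<theta> * a + a / y\<close>, which is at most 1 because
  \<open>\<theta> * y \<ge> 1\<close>.\<close>

lemma (in prob_space) truncated_exp_moment_le_one:
  fixes X :: "'a \<Rightarrow> real"
  assumes X: "integrable M X" "integrable M (\<lambda>\<omega>. \<bar>X \<omega>\<bar> powr t)"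
    and t: "1 \<le> t" "t \<le> 2" and y: "0 < y"
    and a: "expectation X = - a" "0 < a" and A: "expectation (\<lambda>\<omega>. \<bar>X \<omega>\<bar> powr t) = A" "0 < A"
    and q: "q = a * y powr (t - 1) / A" "exp 1 - 1 \<le> q" and \<theta>: "\<theta> = ln (1 + q) / y"
  shows "expectation (\<lambda>\<omega>. exp (\<theta> * X \<omega>) * of_bool (X \<omega> \<le> y)) \<le> 1"
proof -
  have q0: "0 < q" using y a A by (simp add: q)
  have [measurable]: "X \<in> borel_measurable M" using X by simp
  define s where "s = \<theta> * y"
  have s: "s = ln (1 + q)" using y by (simp add: s_def \<theta>)
  have s1: "1 \<le> s"
    using q(2) q0 by (simp add: s ln_ge_iff)
  have \<theta>0: "0 < \<theta>" using y q0 by (simp add: \<theta>)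
  let ?r = "\<lambda>u. 1 + \<theta> * u + \<bar>u\<bar> powr t * (q / y powr t)"
  have bound: "exp (\<theta> * u) * of_bool (u \<le> y) \<le> ?r u" for u
  proof (cases "u \<le> y")
    case True
    have "exp (s * (u / y)) - 1 - s * (u / y) \<le> \<bar>u / y\<bar> powr t * (exp s - 1)"
      using True y t s1 by (intro exp_quotient_le) auto
    moreover have "\<bar>u / y\<bar> powr t = \<bar>u\<bar> powr t / y powr t"
      using y by (simp add: powr_divide)
    moreover have "s * (u / y) = \<theta> * u" "exp s = 1 + q"
      using y q0 by (simp_all add: s_def) (simp add: s s_def[symmetric])
    ultimately show ?thesis
      using True by simp
  next
    case False
    then show ?thesis using y \<theta>0 q0 by simp
  qed
  have "integrable M (\<lambda>\<omega>. exp (\<theta> * X \<omega>) * of_bool (X \<omega> \<le> y))"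
    by (rule integrable_const_bound[of _ "exp (\<theta> * y)"])
      (use \<theta>0 in \<open>auto simp: of_bool_def mult_left_mono\<close>)
  then have "expectation (\<lambda>\<omega>. exp (\<theta> * X \<omega>) * of_bool (X \<omega> \<le> y)) \<le> expectation (\<lambda>\<omega>. ?r (X \<omega>))"
    using X by (intro integral_mono bound) auto
  also have "\<dots> = 1 - \<theta> * a + A * (q / y powr t)"
    using X by (simp add: prob_space a A)
  \<comment> \<open>The choice of \<open>q\<close> is made for this cancellation.\<close>
  also have "A * (q / y powr t) = a / y"
    using A y by (simp add: q powr_diff)
  also have "a / y \<le> \<theta> * a"
    using s1 y a by (simp add: s_def field_simps)
  finally show ?thesis by simp
qed

text \<open>Justifies dividing by \<open>A\<close>: a vanishing moment would force \<open>X\<close>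
  to be 0 almost everywhere and its mean to vanish.\<close>

lemma (in prob_space) expectation_powr_abs_pos:
  fixes X :: "'a \<Rightarrow> real"
  assumes [measurable]: "X \<in> borel_measurable M" and "integrable M (\<lambda>\<omega>. \<bar>X \<omega>\<bar> powr t)"
    and "expectation X \<noteq> 0"
  shows "0 < expectation (\<lambda>\<omega>. \<bar>X \<omega>\<bar> powr t)"
proof (rule ccontr)
  assume "\<not> 0 < expectation (\<lambda>\<omega>. \<bar>X \<omega>\<bar> powr t)"
  moreover have "0 \<le> expectation (\<lambda>\<omega>. \<bar>X \<omega>\<bar> powr t)"
    by (rule integral_nonneg_AE) simp
  ultimately have "expectation (\<lambda>\<omega>. \<bar>X \<omega>\<bar> powr t) = 0"
    by linarith
  then have "AE \<omega> in M. \<bar>X \<omega>\<bar> powr t = 0"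
    using integral_nonneg_eq_0_iff_AE[OF assms(2)] by simp
  then have "expectation X = expectation (\<lambda>_. 0)"
    by (intro integral_cong_AE) auto
  with assms(3) show False by simp
qed

section \<open>Assembling the maximal inequality\<close>

theorem theorem1:
  fixes M :: "'a measure" and X :: "'a \<Rightarrow> real" and \<xi> :: "nat \<Rightarrow> 'a \<Rightarrow> real"
    and a A t x y z :: real
  assumes "prob_space M"
    and "integrable M X"
    and "prob_space.indep_vars M (\<lambda>_. borel) \<xi> {1..}"
    and "\<And>i. i \<ge> 1 \<Longrightarrow> distr M borel (\<xi> i) = distr M borel X"
    and "a = - (LINT \<omega>|M. X \<omega>)" and "a > 0"
    and "0 < z" and "z \<le> x"
    and "1 < t" and "t \<le> 2"
    and "integrable M (\<lambda>\<omega>. \<bar>X \<omega>\<bar> powr t)"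
    and "A = (LINT \<omega>|M. \<bar>X \<omega>\<bar> powr t)"
    and "0 < y" and "y \<le> x"
    and "y powr (t - 1) \<ge> (exp 1 - 1) * A / a"
  shows "\<P>(\<omega> in M. max_before_hit \<xi> z \<omega> > x)
    \<le> A powr (x / y) / a powr (x / y - 1) * (LINT \<omega>|M. real (hit_time \<xi> z \<omega>))
        * y powr (- 1 - (t - 1) * x / y) * ln (1 + a * y powr (t - 1) / A)
      + (1 + A powr (x / y) / a powr (x / y) * y powr (- (t - 1) * x / y))
        * (LINT \<omega>|M. real (hit_time \<xi> z \<omega>)) * \<P>(\<omega> in M. X \<omega> > y)"
proof -
  interpret iid_steps M X \<xi>
    using assms(1-4) by (intro iid_steps.intro iid_steps_axioms.intro)
  define q where "q = a * y powr (t - 1) / A"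
  define \<theta> where "\<theta> = ln (1 + q) / y"
  \<comment> \<open>\<open>1 / r\<close> is the factor common to both summands of the claimed
    bound.\<close>
  define r where "r = q powr (x / y)"
  define T where "T = expectation (\<lambda>\<omega>. real (hit_time \<xi> z \<omega>))"
  define P where "P = prob {\<omega> \<in> space M. X \<omega> > y}"
  let ?B = "prob {\<omega> \<in> space M. big_step \<xi> z y \<omega>}"
  let ?C = "prob {\<omega> \<in> space M. crossing \<xi> z x \<omega> \<and> \<not> big_step \<xi> z y \<omega>}"
  have EX: "expectation X = - a" "expectation X < 0" "expectation X \<noteq> 0"
    using assms(5,6) by auto
  have A: "0 < A"
    unfolding assms(12) using assms(11) EX by (intro expectation_powr_abs_pos) auto
  have y: "0 < y" and x: "0 < x" and a: "0 < a"
    using assms by auto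
  have q0: "0 < q" using y A a by (simp add: q_def)
  then have r0: "0 < r" by (simp add: r_def)
  have \<theta>0: "0 < \<theta>" using q0 y by (simp add: \<theta>_def)
  have "exp 1 - 1 \<le> q"
    using assms(15) A a by (simp add: q_def field_simps)
  then have "expectation (\<lambda>\<omega>. exp (\<theta> * X \<omega>) * of_bool (X \<omega> \<le> y)) \<le> 1"
    using assms(9)
    by (intro truncated_exp_moment_le_one[OF assms(2,11) _ assms(10) y EX(1) a
          assms(12)[symmetric] A q_def _ \<theta>_def]) simp_all
  with \<theta>0 have cross: "(exp (\<theta> * x) - 1) * ?C \<le> ?B - \<theta> * T * expectation X"
    unfolding T_def using EX assms(7) x by (intro prob_crossing_le) auto
  \<comment> \<open>Here \<open>y \<le> x\<close> enters, making the exponent at least 1; it follows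
    that \<open>exp (\<theta> * x) - 1\<close> is at least \<open>r\<close>.\<close>
  have "1 + r \<le> (1 + q) powr (x / y)"
    unfolding r_def using q0 y assms(14) by (intro one_plus_powr_ge) auto
  also have "\<dots> = exp (\<theta> * x)"
    using q0 by (simp add: powr_def \<theta>_def mult.commute)
  finally have "r * ?C \<le> (exp (\<theta> * x) - 1) * ?C"
    by (intro mult_right_mono) auto
  also note cross
  finally have "?C \<le> (?B + \<theta> * a * T) / r"
    using r0 by (simp add: EX field_simps)
  then have "prob {\<omega> \<in> space M. x < max_before_hit \<xi> z \<omega>} \<le> ?B + (?B + \<theta> * a * T) / r"
    using prob_max_before_hit_le[OF EX(2) assms(7), of x y] by linarith
  \<comment> \<open>Collecting the big-step terms gives the second summand of the claim; the Wald
    term gives the first.\<close>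
  also have "\<dots> = \<theta> * a * T / r + (1 + 1 / r) * ?B"
    using r0 by (simp add: field_simps)
  also have "\<dots> \<le> \<theta> * a * T / r + (1 + 1 / r) * (T * P)"
    using prob_big_step_le[OF EX(2) assms(7), of y] r0
    by (intro add_left_mono mult_left_mono) (auto simp: T_def P_def)
  also have r: "1 / r = A powr (x / y) / a powr (x / y) * y powr (- (t - 1) * x / y)"
  proof -
    have "- (t - 1) * x / y = - ((t - 1) * (x / y))"
      by (simp add: algebra_simps diff_divide_distrib)
    then show ?thesis
      using A a y
      by (simp only: r_def q_def powr_minus)
        (simp add: powr_divide powr_mult powr_powr divide_simps)
  qed
  \<comment> \<open>The factor \<open>a\<close> lowers the exponent of \<open>a\<close> in the
    denominator by one, and the \<open>1 / y\<close> in \<theta> accounts for the -1 in the exponent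
    of \<open>y\<close>.\<close>
  also have "\<theta> * a * T / r = A powr (x / y) / a powr (x / y - 1) * T
      * y powr (- 1 - (t - 1) * x / y) * ln (1 + a * y powr (t - 1) / A)"
  proof -
    have split: "\<theta> * a * T / r = \<theta> * a * T * (1 / r)" by simp
    have "- 1 - (t - 1) * x / y = - (t - 1) * x / y - 1"
      by (simp add: algebra_simps diff_divide_distrib)
    then have y_powr: "y powr (- 1 - (t - 1) * x / y) = y powr (- (t - 1) * x / y) / y"
      using y by (simp only: powr_diff) simp
    have a_powr: "a powr (x / y - 1) = a powr (x / y) / a"
      using a by (simp add: powr_diff)
    show ?thesis
      by (simp only: split r y_powr a_powr) (simp add: \<theta>_def q_def[symmetric] ac_simps)
  qed
  finally show ?thesis by (simp add: T_def P_def mult.assoc)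
qed

end
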